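(* Let $1\le p\le\infty$ and let $A,B:L_p(\mathbb{R},\mu)\to L_p(\mathbb{R},\mu)$ be the operators defined, for almost every $t$, by $$(Ax)(t)=\int_{\alpha_1}^{\beta_1}I_{[\alpha,\beta]}(t)\Big(\frac{1}{\delta\sigma_2}\cos(\omega t)\cos(\omega s)+\frac{1}{\delta\sigma_1}\sin(\omega t)\sin(\omega s)+\theta_{A,4}\cos(\omega t)\sin(\omega s)\Big)x(s)\,d\mu_s,$$ $$(Bx)(t)=\int_{\alpha_1}^{\beta_1}I_{[\alpha,\beta]}(t)\Big(\theta_{B,2}\cos(\omega t)\cos(\omega s)+\frac{2\sigma_2\theta_{B,2}}{\sigma_1}\sin(\omega t)\sin(\omega s)\Big)x(s)\,d\mu_s,$$ where $\theta_{A,4},\theta_{B,2},\omega\in\mathbb{R}$, $\delta\in\mathbb{R}\setminus\{0\}$, $\alpha,\beta,\alpha_1,\beta_1\in\mathbb{R}$, $\alpha_1<\beta_1$, $\alpha\le\alpha_1$, $\beta\ge\beta_1$, either $\frac{\omega}{\pi}(\beta_1-\alpha_1)\in\mathbb{Z}$ or $\frac{\omega}{\pi}(\beta_1+\alpha_1)\in\mathbb{Z}$, and $\sigma_1\ne0$, $\sigma_2\neq0$. Let $\{\theta_n\}$ and $\{\varsigma_n\}$ be sequences of real numbers and let $A_n,B_n:L_p(\mathbb{R},\mu)\to L_p(\mathbb{R},\mu)$ be defined, for almost every $t$, by $$(A_nx)(t)=\int_{\alpha_1}^{\beta_1}I_{[\alpha,\beta]}(t)\Big(\frac{1}{\delta\sigma_2}\cos(\omega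 t)\cos(\omega s)+\frac{1}{\delta\sigma_1}\sin(\omega t)\sin(\omega s)+\theta_n\cos(\omega t)\sin(\omega s)\Big)x(s)\,d\mu_s,$$ $$(B_nx)(t)=\int_{\alpha_1}^{\beta_1}I_{[\alpha,\beta]}(t)\Big(\varsigma_n\cos(\omega t)\cos(\omega s)+\frac{2\sigma_2\varsigma_n}{\sigma_1}\sin(\omega t)\sin(\omega s)\Big)x(s)\,d\mu_s.$$ Then: 1. $AB=\delta BA^2$, $A_nB=\delta BA_n^2$, $A_nB_n=\delta B_nA_n^2$ and $AB_n=\delta B_nA^2$ for each positive integer $n$. Moreover, for all $x\in L_p(\mathbb{R},\mu)$ and almost every $t$, $$(AB-BA)x(t)=\theta_{A,4}\sigma_2\theta_{B,2}\int_{\alpha_1}^{\beta_1}I_{[\alpha,\beta]}(t)\cos(\omega t)\sin(\omega s)x(s)\,d\mu_s.$$ 2. If $\theta_n\to0$ as $n\to\infty$, then $A_n\to\tilde A$ in norm, where, for almost every $t$, $$(\tilde Ax)(t)=\int_{\alpha_1}^{\beta_1}I_{[\alpha,\beta]}(t)\Big(\frac{1}{\delta\sigma_2}\cos(\omega t)\cos(\omega s)+\frac{1}{\delta\sigma_1}\sin(\omega t)\sin(\omega s)\Big)x(s)\,d\mu_s,$$ so $A_nB-BA_n\to0$ in norm and $\tilde AB=B\tilde A$. 3. If $\varsigma_n\to0$ as $n\to\infty$, then $B_n\to0$ in norm and so $AB_n-B_nA\to0$ in norm. 4. If $\theta_n\to0$ and $\varsigma_n\to0$ as $n\to\infty$,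 then $A_nB_n-B_nA_n\to0$ in norm. 5. Let $\lambda_0\in\mathrm{cl}(\Lambda)$. If $\theta_{A,4}\sigma_2\theta_{B,2}\tilde\lambda\to0$ when $(\theta_{A,4},\theta_{B,2},\alpha_1,\beta_1,\alpha,\beta,\sigma_1,\sigma_2,\delta,\omega)\to\lambda_0$ within $\Lambda$, then for all $x\in L_p(\mathbb{R},\mu)$ it holds that $\|(AB-BA)x\|_{L_p}\to0$ (along the same limit of parameters, $A$ and $B$ being the operators with these parameters).
   Context: $\mu$ is Lebesgue measure on $\mathbb{R}$; $L_p(\mathbb{R},\mu)$ is the real Lebesgue space; the index in $d\mu_s$ indicates the variable of integration; $I_E$ is the indicator function of the set $E$; convergence in norm means convergence in the operator norm on $L_p(\mathbb{R},\mu)$. The constants are $$\sigma_1=\int_{\alpha_1}^{\beta_1}(\sin(\omega s))^2d\mu_s,\qquad \sigma_2=\int_{\alpha_1}^{\beta_1}(\cos(\omega s))^2d\mu_s=\beta_1-\alpha_1-\sigma_1.$$ The parameter set is $$\Lambda=\Big\{(\theta_{A,4},\theta_{B,2},\alpha_1,\beta_1,\alpha,\beta,\sigma_1,\sigma_2,\delta,\omega)\in\mathbb{R}^{10}:\ \delta\ne0,\ \alpha_1<\beta_1,\ \alpha\le\alpha_1,\ \beta\ge\beta_1,\ \int_{\alpha_1}^{\beta_1}\sin(\omega s)\cos(\omega s)d\mu_s=0,\ \sigma_1=\int_{\alpha_1}^{\beta_1}(\sin(\omega s))^2d\mu_s\ne0,\ \sigma_2=\beta_1-\alpha_1-\sigma_1\ne0\Big\},$$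 and $\mathrm{cl}(\Lambda)$ is its closure in $\mathbb{R}^{10}$. Further, $\tilde\lambda=|\beta-\alpha|^{1/p}|\beta_1-\alpha_1|^{1/q}$ with $\frac1p+\frac1q=1$ if $1<p<\infty$, $\tilde\lambda=|\beta_1-\alpha_1|$ if $p=\infty$, and $\tilde\lambda=|\beta-\alpha|$ if $p=1$. *)

theory Defs
  imports "HOL-Analysis.Analysis" "HOL-Probability.Essential_Supremum"
begin

section \<open>The spaces $L_p(\mathbb{R},\mu)$, $1 \le p \le \infty$\<close>

text \<open>
  Elements of $L_p$ are represented by functions; two functions denote the same element iff they
  agree almost everywhere. Correspondingly, equality of operators (\<open>Lp_op_eq\<close>) is equality almost
  everywhere of the values, and a map on functions is an operator on $L_p$ (\<open>Lp_operator\<close>) if it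
  sends $L_p$ to $L_p$ and respects equality almost everywhere.
  The exponent is an extended nonnegative real, always used with $1 \le p$.
\<close>

definition Lp :: "ennreal \<Rightarrow> (real \<Rightarrow> real) set" where
  "Lp p = {f \<in> borel_measurable lebesgue.
     if p = \<infinity> then esssup lebesgue (\<lambda>t. ereal \<bar>f t\<bar>) < \<infinity>
     else integrable lebesgue (\<lambda>t. \<bar>f t\<bar> powr enn2real p)}"

definition Lp_norm :: "ennreal \<Rightarrow> (real \<Rightarrow> real) \<Rightarrow> real" where
  "Lp_norm p f =
     (if p = \<infinity> then real_of_ereal (esssup lebesgue (\<lambda>t. ereal \<bar>f t\<bar>))
      else (LINT t|lebesgue. \<bar>f t\<bar> powr enn2real p) powr (1 / enn2real p))"

type_synonym fun_op = "(real \<Rightarrow> real) \<Rightarrow> real \<Rightarrow> real"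

definition Lp_operator :: "ennreal \<Rightarrow> fun_op \<Rightarrow> bool" where
  "Lp_operator p T \<longleftrightarrow>
     (\<forall>x\<in>Lp p. T x \<in> Lp p) \<and>
     (\<forall>x\<in>Lp p. \<forall>y\<in>Lp p. (AE t in lebesgue. x t = y t) \<longrightarrow> (AE t in lebesgue. T x t = T y t))"

definition Lp_op_eq :: "ennreal \<Rightarrow> fun_op \<Rightarrow> fun_op \<Rightarrow> bool" where
  "Lp_op_eq p S T \<longleftrightarrow> (\<forall>x\<in>Lp p. AE t in lebesgue. S x t = T x t)"

definition op_diff :: "fun_op \<Rightarrow> fun_op \<Rightarrow> fun_op" where
  "op_diff S T = (\<lambda>x t. S x t - T x t)"

definition op_scale :: "real \<Rightarrow> fun_op \<Rightarrow> fun_op" where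
  "op_scale c T = (\<lambda>x t. c * T x t)"

definition op_zero :: fun_op where
  "op_zero = (\<lambda>x t. 0)"

text \<open>
  The operator norm takes values in \<^typ>\<open>ennreal\<close>, so that the supremum is meaningful also for
  unbounded operators. It is only meaningful for maps that send $L_p$ to $L_p$.
\<close>

definition Lp_op_norm :: "ennreal \<Rightarrow> fun_op \<Rightarrow> ennreal" where
  "Lp_op_norm p T = (SUP x\<in>{x \<in> Lp p. Lp_norm p x \<le> 1}. ennreal (Lp_norm p (T x)))"

definition Lp_op_tendsto :: "ennreal \<Rightarrow> (nat \<Rightarrow> fun_op) \<Rightarrow> fun_op \<Rightarrow> bool" where
  "Lp_op_tendsto p T S \<longleftrightarrow> (\<lambda>n. Lp_op_norm p (op_diff (T n) S)) \<longlonglongrightarrow> 0"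


section \<open>The integral operators\<close>

definition op_A :: "real \<Rightarrow> real \<Rightarrow> real \<Rightarrow> real \<Rightarrow> real \<Rightarrow> real \<Rightarrow> real \<Rightarrow> real \<Rightarrow> real \<Rightarrow> fun_op" where
  "op_A \<alpha>1 \<beta>1 \<alpha> \<beta> \<sigma>1 \<sigma>2 \<delta> \<omega> \<theta> x t =
     (LINT s:{\<alpha>1..\<beta>1}|lebesgue. indicator {\<alpha>..\<beta>} t *
        (1 / (\<delta> * \<sigma>2) * cos (\<omega> * t) * cos (\<omega> * s)
         + 1 / (\<delta> * \<sigma>1) * sin (\<omega> * t) * sin (\<omega> * s)
         + \<theta> * cos (\<omega> * t) * sin (\<omega> * s)) * x s)"

definition op_A_lim :: "real \<Rightarrow> real \<Rightarrow> real \<Rightarrow> real \<Rightarrow> real \<Rightarrow> real \<Rightarrow> real \<Rightarrow> real \<Rightarrow> fun_op" where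
  "op_A_lim \<alpha>1 \<beta>1 \<alpha> \<beta> \<sigma>1 \<sigma>2 \<delta> \<omega> x t =
     (LINT s:{\<alpha>1..\<beta>1}|lebesgue. indicator {\<alpha>..\<beta>} t *
        (1 / (\<delta> * \<sigma>2) * cos (\<omega> * t) * cos (\<omega> * s)
         + 1 / (\<delta> * \<sigma>1) * sin (\<omega> * t) * sin (\<omega> * s)) * x s)"

definition op_B :: "real \<Rightarrow> real \<Rightarrow> real \<Rightarrow> real \<Rightarrow> real \<Rightarrow> real \<Rightarrow> real \<Rightarrow> real \<Rightarrow> fun_op" where
  "op_B \<alpha>1 \<beta>1 \<alpha> \<beta> \<sigma>1 \<sigma>2 \<omega> \<theta> x t =
     (LINT s:{\<alpha>1..\<beta>1}|lebesgue. indicator {\<alpha>..\<beta>} t *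
        (\<theta> * cos (\<omega> * t) * cos (\<omega> * s)
         + 2 * \<sigma>2 * \<theta> / \<sigma>1 * sin (\<omega> * t) * sin (\<omega> * s)) * x s)"


section \<open>The parameter set\<close>

text \<open>
  Parameter tuples are ordered
  $(\theta_{A,4},\theta_{B,2},\alpha_1,\beta_1,\alpha,\beta,\sigma_1,\sigma_2,\delta,\omega)$.
  The product topology on the nested pairs is the topology of $\mathbb{R}^{10}$.
\<close>

type_synonym params =
  "real \<times> real \<times> real \<times> real \<times> real \<times> real \<times> real \<times> real \<times> real \<times> real"

definition Param_set :: "params set" where
  "Param_set = {(\<theta>A, \<theta>B, \<alpha>1, \<beta>1, \<alpha>, \<beta>, \<sigma>1, \<sigma>2, \<delta>, \<omega>).
     \<delta> \<noteq> 0 \<and> \<alpha>1 < \<beta>1 \<and> \<alpha> \<le> \<alpha>1 \<and> \<beta> \<ge> \<beta>1 \<and>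
     (LINT s:{\<alpha>1..\<beta>1}|lebesgue. sin (\<omega> * s) * cos (\<omega> * s)) = 0 \<and>
     \<sigma>1 = (LINT s:{\<alpha>1..\<beta>1}|lebesgue. (sin (\<omega> * s))\<^sup>2) \<and> \<sigma>1 \<noteq> 0 \<and>
     \<sigma>2 = \<beta>1 - \<alpha>1 - \<sigma>1 \<and> \<sigma>2 \<noteq> 0}"

text \<open>The argument \<open>q\<close> is the conjugate exponent of \<open>p\<close> and is only relevant for $1 < p < \infty$.\<close>

definition lambda_tilde :: "ennreal \<Rightarrow> real \<Rightarrow> real \<Rightarrow> real \<Rightarrow> real \<Rightarrow> real \<Rightarrow> real" where
  "lambda_tilde p q \<alpha>1 \<beta>1 \<alpha> \<beta> =
     (if p = \<infinity> then \<bar>\<beta>1 - \<alpha>1\<bar>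
      else if p = 1 then \<bar>\<beta> - \<alpha>\<bar>
      else \<bar>\<beta> - \<alpha>\<bar> powr (1 / enn2real p) * \<bar>\<beta>1 - \<alpha>1\<bar> powr (1 / q))"

end

theory Submission
  imports Defs
begin

text \<open>
  All the operators depend on $x$ only through the two moments
  $C(x) = \int_{\alpha_1}^{\beta_1} \cos(\omega s)\,x(s)\,ds$ and
  $S(x) = \int_{\alpha_1}^{\beta_1} \sin(\omega s)\,x(s)\,ds$, and all their values lie in the span of
  $\cos(\omega t)$ and $\sin(\omega t)$ cut off to $[\alpha,\beta]$. Such an operator is given by three
  coefficients,
  $$T_{a,b,d}\,x = I_{[\alpha,\beta]}\,\big((a\,C(x) + d\,S(x))\cos(\omega t) + b\,S(x)\sin(\omega t)\big).$$
  The condition on $\omega(\beta_1 \pm \alpha_1)/\pi$ says that sine and cosine are orthogonal on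
  $[\alpha_1,\beta_1]$ (\<open>sin_cos_orthogonal\<close>), and $[\alpha,\beta]$ contains that interval, so the moments of
  $T_{a,b,d}\,x$ are $\sigma_2 (a\,C(x) + d\,S(x))$ and $\sigma_1 b\,S(x)$. Hence composition is the
  multiplication of upper triangular $2 \times 2$ matrices with weights $\sigma_1, \sigma_2$
  (\<open>trig_op_compose\<close>), and the algebraic claims are identities between coefficients. In particular
  the commutator of $A$ and $B$ is $T_{0,0,d}$ with $d = \theta_{A,4}\sigma_2\theta_{B,2}$.

  For the claims on convergence, Hoelder's inequality bounds both moments by
  $(\beta_1-\alpha_1)^{1-1/p}\,\|x\|_p$, while the cut-off trigonometric functions have norm at most
  $(\beta-\alpha)^{1/p}$. Therefore
  $\|T_{a,b,d}\,x\|_p \le (|a|+|b|+|d|)\,\tilde\lambda\,\|x\|_p$ (\<open>trig_op_bounded\<close>). Each sequence of operators that is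
  claimed to tend to zero has coefficients $k_n a, k_n b, k_n d$ with $k_n \to 0$, and for variable
  parameters the bound on the commutator is, up to sign and the factor $\|x\|_p$, the quantity that is
  assumed to tend to zero.
\<close>

section \<open>Integrals of $L_p$ functions over an interval\<close>

lemma esssup_abs_nonneg:
  fixes x :: "real \<Rightarrow> real"
  assumes "x \<in> borel_measurable lebesgue"
  shows "0 \<le> esssup lebesgue (\<lambda>t. ereal \<bar>x t\<bar>)"
proof -
  have "esssup lebesgue (\<lambda>t::real. 0::ereal) \<le> esssup lebesgue (\<lambda>t. ereal \<bar>x t\<bar>)"
    by (rule esssup_mono) auto
  then show ?thesis
    by (subst (asm) esssup_const) auto
qed

lemma one_le_enn2real:
  assumes "1 \<le> p" "p \<noteq> \<infinity>"
  shows "1 \<le> enn2real p"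
  using assms enn2real_mono[of 1 p] by (simp add: less_top)

lemma Lp_norm_nonneg:
  assumes "x \<in> Lp p"
  shows "0 \<le> Lp_norm p x"
  using assms esssup_abs_nonneg[of x]
  by (auto simp: Lp_norm_def Lp_def real_of_ereal_pos)

text \<open>
  Hoelder's inequality against the constant function $1$, which is the only case that occurs since
  sine and cosine are bounded by $1$. Young's inequality is applied with the weights $1/p$ and $1 - 1/p$
  rather than with conjugate exponents, so that $p = 1$ needs no separate argument. For $p = \infty$ the
  exponent $1 - 1/p$ is also right, because \<open>enn2real \<infinity> = 0\<close> and \<open>1 / 0 = 0\<close>.
\<close>

lemma Lp_interval_Hoelder:
  fixes x :: "real \<Rightarrow> real"
  assumes p: "1 \<le> p" and x: "x \<in> Lp p" and ab: "a < b"
  shows "set_integrable lebesgue {a..b} x"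
    and "(LINT s:{a..b}|lebesgue. \<bar>x s\<bar>) \<le> (b - a) powr (1 - 1 / enn2real p) * Lp_norm p x"
proof -
  have xm: "x \<in> borel_measurable lebesgue"
    using x by (simp add: Lp_def)
  define L where "L = b - a"
  have L: "L > 0" using ab by (simp add: L_def)
  have ind: "integrable lebesgue (indicator {a..b} :: real \<Rightarrow> real)"
    by (simp add: integrable_indicator_iff emeasure_lborel_Icc_eq)
  have ind_int: "(LINT s|lebesgue. indicator {a..b} s :: real) = L"
    using ab by (simp add: L_def)
  \<comment> \<open>An integrable majorant gives the integrability and the estimate at once.\<close>
  have bound: "set_integrable lebesgue {a..b} x \<and>
      (LINT s:{a..b}|lebesgue. \<bar>x s\<bar>) \<le> (LINT s|lebesgue. g s)"
    if g: "integrable lebesgue g" and le: "AE s in lebesgue. indicator {a..b} s * \<bar>x s\<bar> \<le> g s" for g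
  proof
    have xi: "integrable lebesgue (\<lambda>s. indicator {a..b} s * x s)"
    proof (rule Bochner_Integration.integrable_bound[OF g])
      show "(\<lambda>s. indicator {a..b} s * x s) \<in> borel_measurable lebesgue"
        using xm by (intro borel_measurable_times borel_measurable_indicator) auto
      show "AE s in lebesgue. norm (indicator {a..b} s * x s) \<le> norm (g s)"
        using le by eventually_elim (auto simp: indicator_def split: if_splits)
    qed
    then show "set_integrable lebesgue {a..b} x"
      by (simp add: set_integrable_def)
    have "integrable lebesgue (\<lambda>s. indicator {a..b} s * \<bar>x s\<bar>)"
      using integrable_abs[OF xi] by (simp add: abs_mult)
    then show "(LINT s:{a..b}|lebesgue. \<bar>x s\<bar>) \<le> (LINT s|lebesgue. g s)"
      unfolding set_lebesgue_integral_def using g le by (auto intro!: integral_mono_AE)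
  qed
  have "set_integrable lebesgue {a..b} x \<and>
    (LINT s:{a..b}|lebesgue. \<bar>x s\<bar>) \<le> L powr (1 - 1 / enn2real p) * Lp_norm p x"
  proof (cases "p = \<infinity>")
    case True
    define E where "E = esssup lebesgue (\<lambda>t. ereal \<bar>x t\<bar>)"
    define M where "M = Lp_norm p x"
    have "E < \<infinity>" "0 \<le> E"
      using x True esssup_abs_nonneg[OF xm] by (simp_all add: Lp_def E_def)
    then have E: "E = ereal M"
      using True by (cases E) (simp_all add: M_def Lp_norm_def E_def)
    have "AE s in lebesgue. \<bar>x s\<bar> \<le> M"
      using esssup_AE[of "\<lambda>t. ereal \<bar>x t\<bar>" lebesgue] unfolding E_def[symmetric] E by simp
    then have "AE s in lebesgue. indicator {a..b} s * \<bar>x s\<bar> \<le> M * indicator {a..b} s"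
      by eventually_elim (auto simp: indicator_def)
    from bound[OF _ this] show ?thesis
      using ind ind_int L True by (simp add: M_def mult.commute)
  next
    case False
    define r where "r = enn2real p"
    have r: "r \<ge> 1" using one_le_enn2real[OF p False] by (simp add: r_def)
    define I where "I = (LINT t|lebesgue. \<bar>x t\<bar> powr r)"
    have xr: "integrable lebesgue (\<lambda>t. \<bar>x t\<bar> powr r)"
      using x False by (simp add: Lp_def r_def)
    have norm: "Lp_norm p x = I powr (1 / r)"
      using False by (simp add: Lp_norm_def I_def r_def)
    have "I \<ge> 0" by (simp add: I_def)
    then consider "I = 0" | "I > 0" by linarith
    then show ?thesis
    proof cases
      case 1
      have "AE t in lebesgue. \<bar>x t\<bar> powr r = 0"
        using 1 integral_nonneg_eq_0_iff_AE[OF xr] by (simp add: I_def)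
      then have "AE s in lebesgue. indicator {a..b} s * \<bar>x s\<bar> \<le> 0"
        by eventually_elim simp
      from bound[OF _ this] show ?thesis
        using 1 norm by simp
    next
      case 2
      \<comment> \<open>Young's inequality for the normalised functions \<open>\<bar>x\<bar> powr r / I\<close> and \<open>1 / L\<close>, both of
          integral at most 1 on the interval, multiplied by the normalising factors.\<close>
      define g where "g s = I powr (1 / r) * L powr (1 - 1 / r) *
        (1 / r * (\<bar>x s\<bar> powr r / I) + (1 - 1 / r) * (1 / L * indicator {a..b} s))" for s
      have "indicator {a..b} s * \<bar>x s\<bar> \<le> g s" for s
      proof (cases "s \<in> {a..b} \<and> x s \<noteq> 0")
        case True
        have "(\<bar>x s\<bar> powr r / I) powr (1 / r) * (1 / L) powr (1 - 1 / r)
            \<le> 1 / r * (\<bar>x s\<bar> powr r / I) + (1 - 1 / r) * (1 / L)"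
          using r 2 L True by (intro Youngs_inequality_0) auto
        moreover have "(\<bar>x s\<bar> powr r / I) powr (1 / r) * (1 / L) powr (1 - 1 / r)
            = \<bar>x s\<bar> / (I powr (1 / r) * L powr (1 - 1 / r))"
          using r 2 L True by (simp add: powr_divide powr_powr)
        ultimately have "\<bar>x s\<bar> / (I powr (1 / r) * L powr (1 - 1 / r))
            \<le> 1 / r * (\<bar>x s\<bar> powr r / I) + (1 - 1 / r) * (1 / L)"
          by simp
        then show ?thesis
          using 2 L True by (simp add: g_def pos_divide_le_eq mult.commute)
      next
        case False
        have "0 \<le> g s"
          using r 2 L by (auto simp: g_def intro!: mult_nonneg_nonneg add_nonneg_nonneg)
        with False show ?thesis by auto
      qed
      then have "AE s in lebesgue. indicator {a..b} s * \<bar>x s\<bar> \<le> g s"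
        by simp
      moreover have g: "integrable lebesgue g"
        unfolding g_def using xr ind by (intro integrable_mult_right Bochner_Integration.integrable_add) auto
      ultimately have b: "set_integrable lebesgue {a..b} x \<and>
          (LINT s:{a..b}|lebesgue. \<bar>x s\<bar>) \<le> (LINT s|lebesgue. g s)"
        by (intro bound)
      have "(LINT s|lebesgue. 1 / r * (\<bar>x s\<bar> powr r / I) + (1 - 1 / r) * (1 / L * indicator {a..b} s))
          = (LINT s|lebesgue. 1 / r * (\<bar>x s\<bar> powr r / I))
            + (LINT s|lebesgue. (1 - 1 / r) * (1 / L * indicator {a..b} s))"
        using xr ind by (intro Bochner_Integration.integral_add integrable_mult_right) auto
      also have "\<dots> = 1 / r * (I / I) + (1 - 1 / r) * (1 / L * L)"
        unfolding I_def ind_int[symmetric] by (simp only: integral_mult_right_zero integral_divide_zero)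
      also have "\<dots> = 1"
        using 2 L by simp
      finally have "(LINT s|lebesgue. g s) = I powr (1 / r) * L powr (1 - 1 / r)"
        by (simp only: g_def[abs_def] integral_mult_right_zero mult_1_right)
      with b norm show ?thesis
        by (simp add: r_def mult.commute)
    qed
  qed
  then show "set_integrable lebesgue {a..b} x"
    and "(LINT s:{a..b}|lebesgue. \<bar>x s\<bar>) \<le> (b - a) powr (1 - 1 / enn2real p) * Lp_norm p x"
    by (simp_all add: L_def)
qed

lemma bounded_on_interval_Lp:
  fixes f :: "real \<Rightarrow> real"
  assumes p: "1 \<le> p" and fm: "f \<in> borel_measurable lebesgue"
    and le: "\<And>t. \<bar>f t\<bar> \<le> K * indicator {a..b} t" and ab: "a < b"
  shows "f \<in> Lp p" and "Lp_norm p f \<le> K * (b - a) powr (1 / enn2real p)"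
proof -
  have K: "0 \<le> K"
    using le[of a] ab by simp
  have "f \<in> Lp p \<and> Lp_norm p f \<le> K * (b - a) powr (1 / enn2real p)"
  proof (cases "p = \<infinity>")
    case True
    have fK: "\<bar>f t\<bar> \<le> K" for t
      using le[of t] K by (cases "t \<in> {a..b}") auto
    have "esssup lebesgue (\<lambda>t. ereal \<bar>f t\<bar>) \<le> ereal K"
      using fm fK by (intro esssup_I) auto
    then show ?thesis
      using True fm ab esssup_abs_nonneg[OF fm]
      by (cases "esssup lebesgue (\<lambda>t. ereal \<bar>f t\<bar>)") (auto simp: Lp_def Lp_norm_def)
  next
    case False
    define r where "r = enn2real p"
    have r: "r \<ge> 1" using one_le_enn2real[OF p False] by (simp add: r_def)
    have ind: "integrable lebesgue (\<lambda>t. K powr r * indicator {a..b} t)"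
      by (auto simp: integrable_indicator_iff emeasure_lborel_Icc_eq)
    have pw: "\<bar>f t\<bar> powr r \<le> K powr r * indicator {a..b} t" for t
      using le[of t] r by (auto simp: indicator_def powr_mono2 split: if_splits)
    have fi: "integrable lebesgue (\<lambda>t. \<bar>f t\<bar> powr r)"
      by (rule Bochner_Integration.integrable_bound[OF ind]) (use fm pw in auto)
    have "(LINT t|lebesgue. \<bar>f t\<bar> powr r) \<le> (LINT t|lebesgue. K powr r * indicator {a..b} t)"
      by (rule integral_mono[OF fi ind pw])
    also have "\<dots> = K powr r * (b - a)"
      using ab by simp
    finally have "(LINT t|lebesgue. \<bar>f t\<bar> powr r) powr (1 / r) \<le> (K powr r * (b - a)) powr (1 / r)"
      using r by (intro powr_mono2) auto
    also have "\<dots> = K * (b - a) powr (1 / r)"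
      using r K ab by (simp add: powr_mult powr_powr)
    finally show ?thesis
      using False fi fm by (simp add: Lp_def Lp_norm_def r_def)
  qed
  then show "f \<in> Lp p" "Lp_norm p f \<le> K * (b - a) powr (1 / enn2real p)"
    by simp_all
qed

section \<open>The algebra of trigonometric kernels\<close>

definition cos_moment :: "real \<Rightarrow> real \<Rightarrow> real \<Rightarrow> (real \<Rightarrow> real) \<Rightarrow> real" where
  "cos_moment a b \<omega> x = (LINT s:{a..b}|lebesgue. cos (\<omega> * s) * x s)"

definition sin_moment :: "real \<Rightarrow> real \<Rightarrow> real \<Rightarrow> (real \<Rightarrow> real) \<Rightarrow> real" where
  "sin_moment a b \<omega> x = (LINT s:{a..b}|lebesgue. sin (\<omega> * s) * x s)"

lemma trig_products_integrable:
  "set_integrable lebesgue {a..b} (\<lambda>s::real. (cos (\<omega> * s))\<^sup>2)"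
  "set_integrable lebesgue {a..b} (\<lambda>s::real. (sin (\<omega> * s))\<^sup>2)"
  "set_integrable lebesgue {a..b} (\<lambda>s::real. sin (\<omega> * s) * cos (\<omega> * s))"
  by (auto intro!: absolutely_integrable_continuous_real continuous_intros)

lemma cos_square_integral:
  fixes a b :: real
  assumes "a \<le> b"
  shows "(LINT s:{a..b}|lebesgue. (cos (\<omega> * s))\<^sup>2) = b - a - (LINT s:{a..b}|lebesgue. (sin (\<omega> * s))\<^sup>2)"
proof -
  have "(LINT s:{a..b}|lebesgue. (cos (\<omega> * s))\<^sup>2) + (LINT s:{a..b}|lebesgue. (sin (\<omega> * s))\<^sup>2)
      = (LINT s:{a..b}|lebesgue. (cos (\<omega> * s))\<^sup>2 + (sin (\<omega> * s))\<^sup>2)"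
    by (rule set_integral_add(2)[symmetric]) (rule trig_products_integrable)+
  also have "\<dots> = b - a"
    using assms by (simp add: set_lebesgue_integral_def)
  finally show ?thesis by simp
qed

text \<open>
  The primitive $\sin^2(\omega s)/(2\omega)$ and
  $\sin^2 v - \sin^2 u = \sin(v+u)\sin(v-u)$ turn either alternative of the hypothesis into a
  vanishing factor.
\<close>

lemma sin_cos_orthogonal:
  fixes a b \<omega> :: real
  assumes "\<omega> \<noteq> 0" "a \<le> b" and "\<omega> / pi * (b - a) \<in> \<int> \<or> \<omega> / pi * (b + a) \<in> \<int>"
  shows "(LINT s:{a..b}|lebesgue. sin (\<omega> * s) * cos (\<omega> * s)) = 0"
proof -
  have sin0: "sin (\<omega> * y) = 0" if "\<omega> / pi * y \<in> \<int>" for y :: real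
  proof -
    from that obtain k where "\<omega> / pi * y = of_int k" by (auto elim: Ints_cases)
    then have "\<omega> * y = of_int k * pi" by (simp add: field_simps)
    then show ?thesis by (auto simp: sin_zero_iff_int2)
  qed
  have "((\<lambda>s. sin (\<omega> * s) * cos (\<omega> * s)) has_integral
      (sin (\<omega> * b))\<^sup>2 / (2 * \<omega>) - (sin (\<omega> * a))\<^sup>2 / (2 * \<omega>)) {a..b}"
    using assms(1,2)
    by (intro fundamental_theorem_of_calculus)
      (auto intro!: derivative_eq_intros simp: has_real_derivative_iff_has_vector_derivative[symmetric])
  moreover have "(sin (\<omega> * b))\<^sup>2 - (sin (\<omega> * a))\<^sup>2 = sin (\<omega> * (b + a)) * sin (\<omega> * (b - a))"
    using sin_cos_squared_add[of "\<omega> * a"] sin_cos_squared_add[of "\<omega> * b"]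
    unfolding distrib_left right_diff_distrib sin_add sin_diff by algebra
  moreover have "sin (\<omega> * (b + a)) * sin (\<omega> * (b - a)) = 0"
    using assms(3) sin0 by auto
  ultimately have "((\<lambda>s. sin (\<omega> * s) * cos (\<omega> * s)) has_integral 0) {a..b}"
    by (simp flip: diff_divide_distrib)
  then show ?thesis
    using set_lebesgue_integral_eq_integral(2)[OF trig_products_integrable(3), of a b \<omega>]
    by (simp add: integral_unique)
qed

locale trig_kernel =
  fixes \<alpha>1 \<beta>1 \<alpha> \<beta> \<sigma>1 \<sigma>2 \<omega> :: real
  assumes nonempty: "\<alpha>1 < \<beta>1" and left: "\<alpha> \<le> \<alpha>1" and right: "\<beta>1 \<le> \<beta>"
    and orthogonal: "(LINT s:{\<alpha>1..\<beta>1}|lebesgue. sin (\<omega> * s) * cos (\<omega> * s)) = 0"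
    and \<sigma>1_eq: "\<sigma>1 = (LINT s:{\<alpha>1..\<beta>1}|lebesgue. (sin (\<omega> * s))\<^sup>2)"
    and \<sigma>2_eq: "\<sigma>2 = (LINT s:{\<alpha>1..\<beta>1}|lebesgue. (cos (\<omega> * s))\<^sup>2)"
    and \<sigma>1_nz: "\<sigma>1 \<noteq> 0" and \<sigma>2_nz: "\<sigma>2 \<noteq> 0"
begin

text \<open>
  The coefficients \<open>a\<close>, \<open>b\<close> stand before $\cos\cos$ and $\sin\sin$ in the kernel, and \<open>d\<close> before
  $\cos(\omega t)\sin(\omega s)$. The family without $\sin(\omega t)\cos(\omega s)$ is closed under
  composition, like triangular matrices.
\<close>

definition trig_op :: "real \<Rightarrow> real \<Rightarrow> real \<Rightarrow> fun_op" where
  "trig_op a b d x t = indicator {\<alpha>..\<beta>} t *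
     ((a * cos_moment \<alpha>1 \<beta>1 \<omega> x + d * sin_moment \<alpha>1 \<beta>1 \<omega> x) * cos (\<omega> * t)
      + b * sin_moment \<alpha>1 \<beta>1 \<omega> x * sin (\<omega> * t))"

abbreviation "A \<equiv> op_A \<alpha>1 \<beta>1 \<alpha> \<beta> \<sigma>1 \<sigma>2"
abbreviation "B \<equiv> op_B \<alpha>1 \<beta>1 \<alpha> \<beta> \<sigma>1 \<sigma>2 \<omega>"

lemma moment_integrable:
  assumes "set_integrable lebesgue {\<alpha>1..\<beta>1} x"
  shows "set_integrable lebesgue {\<alpha>1..\<beta>1} (\<lambda>s. cos (\<omega> * s) * x s)"
    and "set_integrable lebesgue {\<alpha>1..\<beta>1} (\<lambda>s. sin (\<omega> * s) * x s)"
proof -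
  have "set_integrable lebesgue {\<alpha>1..\<beta>1} (\<lambda>s. g s * x s)"
    if g: "continuous_on UNIV g" "\<And>s. \<bar>g s\<bar> \<le> 1" for g :: "real \<Rightarrow> real"
  proof (rule absolutely_integrable_bounded_measurable_product_real[OF _ _ _ assms])
    show "g \<in> borel_measurable (lebesgue_on {\<alpha>1..\<beta>1})"
      using g(1) by (intro continuous_imp_measurable_on_sets_lebesgue continuous_on_subset[OF g(1)]) auto
    show "bounded (g ` {\<alpha>1..\<beta>1})"
      using g(2) by (auto simp: bounded_iff)
  qed auto
  from this[of "\<lambda>s. cos (\<omega> * s)"] this[of "\<lambda>s. sin (\<omega> * s)"]
  show "set_integrable lebesgue {\<alpha>1..\<beta>1} (\<lambda>s. cos (\<omega> * s) * x s)"
    and "set_integrable lebesgue {\<alpha>1..\<beta>1} (\<lambda>s. sin (\<omega> * s) * x s)"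
    by (simp_all add: continuous_intros)
qed

text \<open>
  Integrability of \<open>x\<close> matters here: it allows the integral of the kernel to be split into the two moments.
\<close>

lemma kernel_integral:
  assumes "set_integrable lebesgue {\<alpha>1..\<beta>1} x"
  shows "(LINT s:{\<alpha>1..\<beta>1}|lebesgue. u * (cos (\<omega> * s) * x s) + v * (sin (\<omega> * s) * x s))
    = u * cos_moment \<alpha>1 \<beta>1 \<omega> x + v * sin_moment \<alpha>1 \<beta>1 \<omega> x"
  using moment_integrable[OF assms] by (simp add: cos_moment_def sin_moment_def)

lemma op_A_eq_trig_op:
  assumes "set_integrable lebesgue {\<alpha>1..\<beta>1} x"
  shows "A \<delta> \<omega> \<theta> x = trig_op (1 / (\<delta> * \<sigma>2)) (1 / (\<delta> * \<sigma>1)) \<theta> x"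
proof
  fix t
  have "A \<delta> \<omega> \<theta> x t = (LINT s:{\<alpha>1..\<beta>1}|lebesgue.
      (indicator {\<alpha>..\<beta>} t * (1 / (\<delta> * \<sigma>2)) * cos (\<omega> * t)) * (cos (\<omega> * s) * x s)
      + (indicator {\<alpha>..\<beta>} t * (1 / (\<delta> * \<sigma>1) * sin (\<omega> * t) + \<theta> * cos (\<omega> * t))) * (sin (\<omega> * s) * x s))"
    unfolding op_A_def by (rule arg_cong[where f = "set_lebesgue_integral lebesgue {\<alpha>1..\<beta>1}"])
      (simp add: fun_eq_iff algebra_simps)
  then show "A \<delta> \<omega> \<theta> x t = trig_op (1 / (\<delta> * \<sigma>2)) (1 / (\<delta> * \<sigma>1)) \<theta> x t"
    unfolding kernel_integral[OF assms] by (simp add: trig_op_def algebra_simps)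
qed

lemma op_B_eq_trig_op:
  assumes "set_integrable lebesgue {\<alpha>1..\<beta>1} x"
  shows "B \<theta> x = trig_op \<theta> (2 * \<sigma>2 * \<theta> / \<sigma>1) 0 x"
proof
  fix t
  have "B \<theta> x t = (LINT s:{\<alpha>1..\<beta>1}|lebesgue.
      (indicator {\<alpha>..\<beta>} t * \<theta> * cos (\<omega> * t)) * (cos (\<omega> * s) * x s)
      + (indicator {\<alpha>..\<beta>} t * (2 * \<sigma>2 * \<theta> / \<sigma>1) * sin (\<omega> * t)) * (sin (\<omega> * s) * x s))"
    unfolding op_B_def by (rule arg_cong[where f = "set_lebesgue_integral lebesgue {\<alpha>1..\<beta>1}"])
      (simp add: fun_eq_iff algebra_simps)
  then show "B \<theta> x t = trig_op \<theta> (2 * \<sigma>2 * \<theta> / \<sigma>1) 0 x t"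
    unfolding kernel_integral[OF assms] by (simp add: trig_op_def algebra_simps)
qed

text \<open>
  On $[\alpha_1,\beta_1]$ the cut-off is $1$, so orthogonality leaves only the square integrals
  $\sigma_1$ and $\sigma_2$.
\<close>

lemma moments_trig_op:
  "cos_moment \<alpha>1 \<beta>1 \<omega> (trig_op a b d x)
     = \<sigma>2 * (a * cos_moment \<alpha>1 \<beta>1 \<omega> x + d * sin_moment \<alpha>1 \<beta>1 \<omega> x)"
  "sin_moment \<alpha>1 \<beta>1 \<omega> (trig_op a b d x) = \<sigma>1 * b * sin_moment \<alpha>1 \<beta>1 \<omega> x"
proof -
  define u where "u = a * cos_moment \<alpha>1 \<beta>1 \<omega> x + d * sin_moment \<alpha>1 \<beta>1 \<omega> x"
  define v where "v = b * sin_moment \<alpha>1 \<beta>1 \<omega> x"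
  have val: "trig_op a b d x s = u * cos (\<omega> * s) + v * sin (\<omega> * s)" if "s \<in> {\<alpha>1..\<beta>1}" for s
    using that left right by (simp add: trig_op_def u_def v_def)
  have "cos_moment \<alpha>1 \<beta>1 \<omega> (trig_op a b d x)
      = (LINT s:{\<alpha>1..\<beta>1}|lebesgue. u * (cos (\<omega> * s))\<^sup>2 + v * (sin (\<omega> * s) * cos (\<omega> * s)))"
    unfolding cos_moment_def
    by (rule set_lebesgue_integral_cong) (auto simp: val algebra_simps power2_eq_square)
  also have "\<dots> = u * \<sigma>2"
    using trig_products_integrable by (simp add: orthogonal \<sigma>2_eq)
  finally show "cos_moment \<alpha>1 \<beta>1 \<omega> (trig_op a b d x)
     = \<sigma>2 * (a * cos_moment \<alpha>1 \<beta>1 \<omega> x + d * sin_moment \<alpha>1 \<beta>1 \<omega> x)"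
    by (simp add: u_def)
  have "sin_moment \<alpha>1 \<beta>1 \<omega> (trig_op a b d x)
      = (LINT s:{\<alpha>1..\<beta>1}|lebesgue. u * (sin (\<omega> * s) * cos (\<omega> * s)) + v * (sin (\<omega> * s))\<^sup>2)"
    unfolding sin_moment_def
    by (rule set_lebesgue_integral_cong) (auto simp: val algebra_simps power2_eq_square)
  also have "\<dots> = v * \<sigma>1"
    using trig_products_integrable by (simp add: orthogonal \<sigma>1_eq)
  finally show "sin_moment \<alpha>1 \<beta>1 \<omega> (trig_op a b d x) = \<sigma>1 * b * sin_moment \<alpha>1 \<beta>1 \<omega> x"
    by (simp add: v_def)
qed

lemma trig_op_compose:
  "trig_op a b d (trig_op a' b' d' x)
     = trig_op (\<sigma>2 * a * a') (\<sigma>1 * b * b') (\<sigma>2 * a * d' + \<sigma>1 * d * b') x"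
proof
  fix t
  show "trig_op a b d (trig_op a' b' d' x) t
     = trig_op (\<sigma>2 * a * a') (\<sigma>1 * b * b') (\<sigma>2 * a * d' + \<sigma>1 * d * b') x t"
    unfolding trig_op_def[of a b d] moments_trig_op
    unfolding trig_op_def by (simp add: algebra_simps)
qed

lemma trig_op_diff: "op_diff (trig_op a b d) (trig_op a' b' d') = trig_op (a - a') (b - b') (d - d')"
  by (simp add: fun_eq_iff op_diff_def trig_op_def algebra_simps)

lemma trig_op_scale: "op_scale c (trig_op a b d) = trig_op (c * a) (c * b) (c * d)"
  by (simp add: fun_eq_iff op_scale_def trig_op_def algebra_simps)

section \<open>Norm bounds\<close>

text \<open>
  The number $\tilde\lambda$ written as one formula for all exponents: for $p = \infty$ the convention
  \<open>1 / enn2real \<infinity> = 0\<close> makes the first factor $1$, and for $p = 1$ the second factor is $1$.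
\<close>

definition norm_const :: "ennreal \<Rightarrow> real" where
  "norm_const p = (\<beta> - \<alpha>) powr (1 / enn2real p) * (\<beta>1 - \<alpha>1) powr (1 - 1 / enn2real p)"

lemma norm_const_nonneg: "0 \<le> norm_const p"
  by (simp add: norm_const_def)

lemma norm_const_eq_lambda_tilde:
  assumes "1 \<le> p" and "1 < p \<Longrightarrow> p < \<infinity> \<Longrightarrow> 1 / enn2real p + 1 / q = 1"
  shows "lambda_tilde p q \<alpha>1 \<beta>1 \<alpha> \<beta> = norm_const p"
proof -
  consider "p = \<infinity>" | "p = 1" | "1 < p" "p < \<infinity>"
    using assms(1) by (metis infinity_ennreal_def le_less top.not_eq_extremum)
  then show ?thesis
  proof cases
    case 3
    then have "1 / q = 1 - 1 / enn2real p" using assms(2) by simp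
    with 3 show ?thesis
      using nonempty left right by (auto simp: lambda_tilde_def norm_const_def)
  qed (use nonempty left right in \<open>auto simp: lambda_tilde_def norm_const_def\<close>)
qed

lemma moment_bounds:
  assumes p: "1 \<le> p" and x: "x \<in> Lp p"
  shows "\<bar>cos_moment \<alpha>1 \<beta>1 \<omega> x\<bar> \<le> (\<beta>1 - \<alpha>1) powr (1 - 1 / enn2real p) * Lp_norm p x"
    and "\<bar>sin_moment \<alpha>1 \<beta>1 \<omega> x\<bar> \<le> (\<beta>1 - \<alpha>1) powr (1 - 1 / enn2real p) * Lp_norm p x"
proof -
  note xi = Lp_interval_Hoelder(1)[OF p x nonempty]
  have *: "\<bar>LINT s:{\<alpha>1..\<beta>1}|lebesgue. g s * x s\<bar> \<le> (\<beta>1 - \<alpha>1) powr (1 - 1 / enn2real p) * Lp_norm p x"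
    if g: "set_integrable lebesgue {\<alpha>1..\<beta>1} (\<lambda>s. g s * x s)" "\<And>s. \<bar>g s\<bar> \<le> 1" for g :: "real \<Rightarrow> real"
  proof -
    have "\<bar>LINT s:{\<alpha>1..\<beta>1}|lebesgue. g s * x s\<bar> \<le> (LINT s:{\<alpha>1..\<beta>1}|lebesgue. \<bar>g s * x s\<bar>)"
      using set_integral_norm_bound[OF g(1)] by simp
    also have "\<dots> \<le> (LINT s:{\<alpha>1..\<beta>1}|lebesgue. \<bar>x s\<bar>)"
      using g xi by (intro set_integral_mono set_integrable_abs)
        (auto simp: abs_mult mult_left_le_one_le)
    also have "\<dots> \<le> (\<beta>1 - \<alpha>1) powr (1 - 1 / enn2real p) * Lp_norm p x"
      by (rule Lp_interval_Hoelder(2)[OF p x nonempty])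
    finally show ?thesis .
  qed
  show "\<bar>cos_moment \<alpha>1 \<beta>1 \<omega> x\<bar> \<le> (\<beta>1 - \<alpha>1) powr (1 - 1 / enn2real p) * Lp_norm p x"
    unfolding cos_moment_def by (rule *[OF moment_integrable(1)[OF xi]]) simp
  show "\<bar>sin_moment \<alpha>1 \<beta>1 \<omega> x\<bar> \<le> (\<beta>1 - \<alpha>1) powr (1 - 1 / enn2real p) * Lp_norm p x"
    unfolding sin_moment_def by (rule *[OF moment_integrable(2)[OF xi]]) simp
qed

lemma trig_op_bounded:
  assumes p: "1 \<le> p"
  shows "trig_op a b d x \<in> Lp p"
    and "x \<in> Lp p \<Longrightarrow> Lp_norm p (trig_op a b d x) \<le> (\<bar>a\<bar> + \<bar>b\<bar> + \<bar>d\<bar>) * norm_const p * Lp_norm p x"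
proof -
  define C where "C = cos_moment \<alpha>1 \<beta>1 \<omega> x"
  define S where "S = sin_moment \<alpha>1 \<beta>1 \<omega> x"
  define K where "K = \<bar>a\<bar> * \<bar>C\<bar> + \<bar>d\<bar> * \<bar>S\<bar> + \<bar>b\<bar> * \<bar>S\<bar>"
  have "(\<lambda>t. (a * C + d * S) * cos (\<omega> * t) + b * S * sin (\<omega> * t)) \<in> borel_measurable lborel"
    by simp
  then have "(\<lambda>t. (a * C + d * S) * cos (\<omega> * t) + b * S * sin (\<omega> * t)) \<in> borel_measurable lebesgue"
    by (rule measurable_completion)
  then have m: "trig_op a b d x \<in> borel_measurable lebesgue"
    unfolding trig_op_def[abs_def] C_def[symmetric] S_def[symmetric]
    by (intro borel_measurable_times borel_measurable_indicator) auto
  have le: "\<bar>trig_op a b d x t\<bar> \<le> K * indicator {\<alpha>..\<beta>} t" for t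
  proof -
    have "\<bar>(a * C + d * S) * cos (\<omega> * t) + b * S * sin (\<omega> * t)\<bar>
        \<le> \<bar>a * C + d * S\<bar> * \<bar>cos (\<omega> * t)\<bar> + \<bar>b * S\<bar> * \<bar>sin (\<omega> * t)\<bar>"
      by (metis abs_mult abs_triangle_ineq)
    also have "\<dots> \<le> \<bar>a * C + d * S\<bar> * 1 + \<bar>b * S\<bar> * 1"
      by (intro add_mono mult_left_mono) auto
    also have "\<dots> \<le> K"
      using abs_triangle_ineq[of "a * C" "d * S"] by (simp add: K_def abs_mult)
    finally show ?thesis
      by (simp add: trig_op_def C_def S_def indicator_def)
  qed
  have "\<alpha> < \<beta>" using nonempty left right by linarith
  note bd = bounded_on_interval_Lp[OF p m le this]
  show "trig_op a b d x \<in> Lp p" by (rule bd(1))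
  assume x: "x \<in> Lp p"
  have "K \<le> (\<bar>a\<bar> + \<bar>b\<bar> + \<bar>d\<bar>) * ((\<beta>1 - \<alpha>1) powr (1 - 1 / enn2real p) * Lp_norm p x)"
    using moment_bounds[OF p x] unfolding K_def C_def[symmetric] S_def[symmetric] distrib_right
    by (smt (verit) mult_left_mono abs_ge_zero)
  then have "K * (\<beta> - \<alpha>) powr (1 / enn2real p) \<le>
      (\<bar>a\<bar> + \<bar>b\<bar> + \<bar>d\<bar>) * ((\<beta>1 - \<alpha>1) powr (1 - 1 / enn2real p) * Lp_norm p x) * (\<beta> - \<alpha>) powr (1 / enn2real p)"
    by (intro mult_right_mono) auto
  with bd(2) show "Lp_norm p (trig_op a b d x) \<le> (\<bar>a\<bar> + \<bar>b\<bar> + \<bar>d\<bar>) * norm_const p * Lp_norm p x"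
    by (simp add: norm_const_def mult_ac)
qed

text \<open>
  Functions that agree almost everywhere have the same moments, hence equal images.
\<close>

lemma trig_op_Lp_operator:
  assumes p: "1 \<le> p" and T: "\<And>x. x \<in> Lp p \<Longrightarrow> T x = trig_op a b d x"
  shows "Lp_operator p T"
  unfolding Lp_operator_def
proof (intro conjI ballI impI)
  show "T x \<in> Lp p" if "x \<in> Lp p" for x
    using T[OF that] trig_op_bounded(1)[OF p] by simp
  fix x y assume xy: "x \<in> Lp p" "y \<in> Lp p" and ae: "AE t in lebesgue. x t = y t"
  have mx: "x \<in> borel_measurable lebesgue" "y \<in> borel_measurable lebesgue"
    using xy by (simp_all add: Lp_def)
  have *: "(LINT s:{\<alpha>1..\<beta>1}|lebesgue. g s * x s) = (LINT s:{\<alpha>1..\<beta>1}|lebesgue. g s * y s)"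
    if "g \<in> borel_measurable lborel" for g :: "real \<Rightarrow> real"
  proof -
    have [measurable]: "g \<in> borel_measurable lebesgue"
      using that by (rule measurable_completion)
    note mx[measurable]
    have "AE s in lebesgue. indicator {\<alpha>1..\<beta>1} s *\<^sub>R (g s * x s) = indicator {\<alpha>1..\<beta>1} s *\<^sub>R (g s * y s)"
      using ae by eventually_elim simp
    then show ?thesis
      unfolding set_lebesgue_integral_def by (intro integral_cong_AE) (auto intro!: borel_measurable_times borel_measurable_indicator)
  qed
  have "cos_moment \<alpha>1 \<beta>1 \<omega> x = cos_moment \<alpha>1 \<beta>1 \<omega> y" "sin_moment \<alpha>1 \<beta>1 \<omega> x = sin_moment \<alpha>1 \<beta>1 \<omega> y"
    unfolding cos_moment_def sin_moment_def by (rule *; simp)+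
  then show "AE t in lebesgue. T x t = T y t"
    by (simp add: T[OF xy(1)] T[OF xy(2)] trig_op_def)
qed

lemma trig_op_tendsto:
  assumes p: "1 \<le> p" and k: "k \<longlonglongrightarrow> 0"
    and eq: "\<And>n x. x \<in> Lp p \<Longrightarrow> op_diff (F n) G x = trig_op (k n * a) (k n * b) (k n * d) x"
  shows "Lp_op_tendsto p F G"
proof -
  define M where "M = (\<bar>a\<bar> + \<bar>b\<bar> + \<bar>d\<bar>) * norm_const p"
  have M: "0 \<le> M" by (simp add: M_def norm_const_nonneg)
  have "Lp_op_norm p (op_diff (F n) G) \<le> ennreal (\<bar>k n\<bar> * M)" for n
    unfolding Lp_op_norm_def
  proof (rule SUP_least, clarify)
    fix x assume x: "x \<in> Lp p" "Lp_norm p x \<le> 1"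
    have "Lp_norm p (op_diff (F n) G x) \<le> \<bar>k n\<bar> * M * Lp_norm p x"
      using trig_op_bounded(2)[OF p x(1), of "k n * a" "k n * b" "k n * d"]
      by (simp add: eq[OF x(1)] M_def abs_mult algebra_simps)
    also have "\<dots> \<le> \<bar>k n\<bar> * M * 1"
      using x(2) M by (intro mult_left_mono) auto
    finally show "ennreal (Lp_norm p (op_diff (F n) G x)) \<le> ennreal (\<bar>k n\<bar> * M)"
      by (simp add: ennreal_leI)
  qed
  then have le: "\<forall>\<^sub>F n in sequentially. Lp_op_norm p (op_diff (F n) G) \<le> ennreal (\<bar>k n\<bar> * M)"
    by (rule always_eventually[OF allI])
  have "(\<lambda>n. ennreal (\<bar>k n\<bar> * M)) \<longlonglongrightarrow> ennreal (\<bar>0\<bar> * M)"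
    by (intro tendsto_ennrealI tendsto_mult tendsto_rabs k tendsto_const)
  then have lim: "(\<lambda>n. ennreal (\<bar>k n\<bar> * M)) \<longlonglongrightarrow> 0"
    by simp
  show ?thesis
    unfolding Lp_op_tendsto_def
    by (rule tendsto_sandwich[OF _ le tendsto_const lim]) simp
qed

section \<open>The operators $A$ and $B$\<close>

context
  fixes p :: ennreal and \<delta> :: real
  assumes p: "1 \<le> p" and \<delta>: "\<delta> \<noteq> 0"
begin

lemma A_eq: "x \<in> Lp p \<Longrightarrow> A \<delta> \<omega> \<theta> x = trig_op (1 / (\<delta> * \<sigma>2)) (1 / (\<delta> * \<sigma>1)) \<theta> x"
  by (rule op_A_eq_trig_op) (rule Lp_interval_Hoelder(1)[OF p _ nonempty])

lemma B_eq: "x \<in> Lp p \<Longrightarrow> B \<theta> x = trig_op \<theta> (2 * \<sigma>2 * \<theta> / \<sigma>1) 0 x"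
  by (rule op_B_eq_trig_op) (rule Lp_interval_Hoelder(1)[OF p _ nonempty])

lemmas AB_simps = A_eq B_eq trig_op_bounded(1)[OF p] trig_op_compose

text \<open>
  Each diagonal product in $A^2$ contributes one $\theta/\delta$ to the coefficient before
  $\cos(\omega t)\sin(\omega s)$, which is therefore $2\sigma_2\theta\zeta$ in $\delta BA^2$. In $AB$ this
  coefficient is $\sigma_1\theta$ times the second coefficient of $B$, and the choice
  $2\sigma_2\zeta/\sigma_1$ of the latter makes the two agree.
\<close>

lemma covariance:
  assumes x: "x \<in> Lp p"
  shows "(A \<delta> \<omega> \<theta> \<circ> B \<zeta>) x = op_scale \<delta> (B \<zeta> \<circ> (A \<delta> \<omega> \<theta> ^^ 2)) x"
proof -
  define b where "b = 2 * \<sigma>2 * \<zeta> / \<sigma>1"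
  have "op_scale \<delta> (B \<zeta> \<circ> (A \<delta> \<omega> \<theta> ^^ 2)) x
      = op_scale \<delta> (trig_op (\<sigma>2 * \<zeta> * (\<sigma>2 * (1 / (\<delta> * \<sigma>2)) * (1 / (\<delta> * \<sigma>2))))
          (\<sigma>1 * b * (\<sigma>1 * (1 / (\<delta> * \<sigma>1)) * (1 / (\<delta> * \<sigma>1))))
          (\<sigma>2 * \<zeta> * (\<sigma>2 * (1 / (\<delta> * \<sigma>2)) * \<theta> + \<sigma>1 * \<theta> * (1 / (\<delta> * \<sigma>1))))) x"
    by (simp only: op_scale_def o_apply numeral_2_eq_2 funpow.simps id_apply AB_simps x b_def
        mult_zero_left mult_zero_right add_0_right)
  also have "\<dots> = trig_op (\<sigma>2 * (1 / (\<delta> * \<sigma>2)) * \<zeta>) (\<sigma>1 * (1 / (\<delta> * \<sigma>1)) * b) (\<sigma>1 * \<theta> * b) x"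
    unfolding trig_op_scale using \<sigma>1_nz \<sigma>2_nz \<delta>
    by (intro arg_cong3[where f = "\<lambda>a b d. trig_op a b d x"]) (simp_all add: b_def field_simps)
  also have "\<dots> = (A \<delta> \<omega> \<theta> \<circ> B \<zeta>) x"
    by (simp only: o_apply AB_simps x b_def mult_zero_right add_0_left)
  finally show ?thesis by (rule sym)
qed

text \<open>
  The diagonal coefficients commute. Of the mixed coefficient, $AB$ contributes
  $\sigma_1\theta\cdot 2\sigma_2\zeta/\sigma_1 = 2\sigma_2\theta\zeta$ and $BA$ only
  $\sigma_2\theta\zeta$.
\<close>

lemma commutator:
  assumes x: "x \<in> Lp p"
  shows "op_diff (A \<delta> \<omega> \<theta> \<circ> B \<zeta>) (B \<zeta> \<circ> A \<delta> \<omega> \<theta>) x = trig_op 0 0 (\<theta> * \<sigma>2 * \<zeta>) x"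
proof -
  define b where "b = 2 * \<sigma>2 * \<zeta> / \<sigma>1"
  have "op_diff (A \<delta> \<omega> \<theta> \<circ> B \<zeta>) (B \<zeta> \<circ> A \<delta> \<omega> \<theta>) x
      = op_diff (trig_op (\<sigma>2 * (1 / (\<delta> * \<sigma>2)) * \<zeta>) (\<sigma>1 * (1 / (\<delta> * \<sigma>1)) * b) (\<sigma>1 * \<theta> * b))
          (trig_op (\<sigma>2 * \<zeta> * (1 / (\<delta> * \<sigma>2))) (\<sigma>1 * b * (1 / (\<delta> * \<sigma>1))) (\<sigma>2 * \<zeta> * \<theta>)) x"
    by (simp only: op_diff_def o_apply AB_simps x b_def
        mult_zero_left mult_zero_right add_0_left add_0_right)
  also have "\<dots> = trig_op 0 0 (\<theta> * \<sigma>2 * \<zeta>) x"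
    unfolding trig_op_diff using \<sigma>1_nz
    by (intro arg_cong3[where f = "\<lambda>a b d. trig_op a b d x"]) (simp_all add: b_def field_simps)
  finally show ?thesis .
qed

end

end

lemma op_A_lim_eq_op_A: "op_A_lim \<alpha>1 \<beta>1 \<alpha> \<beta> \<sigma>1 \<sigma>2 \<delta> \<omega> = op_A \<alpha>1 \<beta>1 \<alpha> \<beta> \<sigma>1 \<sigma>2 \<delta> \<omega> 0"
  by (simp add: fun_eq_iff op_A_lim_def op_A_def)

section \<open>Variable parameters\<close>

lemma Param_set_trig_kernel:
  assumes "(\<theta>A, \<theta>B, \<alpha>1, \<beta>1, \<alpha>, \<beta>, \<sigma>1, \<sigma>2, \<delta>, \<omega>) \<in> Param_set"
  shows "trig_kernel \<alpha>1 \<beta>1 \<alpha> \<beta> \<sigma>1 \<sigma>2 \<omega>" and "\<delta> \<noteq> 0"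
  using assms cos_square_integral[of \<alpha>1 \<beta>1 \<omega>] by (auto simp: Param_set_def trig_kernel_def)

text \<open>
  At each point of the parameter set the commutator has the single coefficient
  $\theta_{A,4}\sigma_2\theta_{B,2}$, so its value at \<open>x\<close> has norm at most the absolute value of the given
  quantity times the norm of \<open>x\<close>, and \<open>x\<close> does not vary with the parameters.
\<close>

lemma commutator_norm_tendsto:
  assumes p: "1 \<le> p" and q: "1 < p \<Longrightarrow> p < \<infinity> \<Longrightarrow> 1 / enn2real p + 1 / q = 1"
    and x: "x \<in> Lp p"
    and lim: "((\<lambda>(\<theta>A, \<theta>B, \<alpha>1, \<beta>1, \<alpha>, \<beta>, \<sigma>1, \<sigma>2, \<delta>, \<omega>).
            \<theta>A * \<sigma>2 * \<theta>B * lambda_tilde p q \<alpha>1 \<beta>1 \<alpha> \<beta>) \<longlongrightarrow> 0) (at l0 within Param_set)"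
      (is "(?g \<longlongrightarrow> 0) _")
  shows "((\<lambda>(\<theta>A, \<theta>B, \<alpha>1, \<beta>1, \<alpha>, \<beta>, \<sigma>1, \<sigma>2, \<delta>, \<omega>).
               Lp_norm p
                 (op_diff
                   (op_A \<alpha>1 \<beta>1 \<alpha> \<beta> \<sigma>1 \<sigma>2 \<delta> \<omega> \<theta>A \<circ> op_B \<alpha>1 \<beta>1 \<alpha> \<beta> \<sigma>1 \<sigma>2 \<omega> \<theta>B)
                   (op_B \<alpha>1 \<beta>1 \<alpha> \<beta> \<sigma>1 \<sigma>2 \<omega> \<theta>B \<circ> op_A \<alpha>1 \<beta>1 \<alpha> \<beta> \<sigma>1 \<sigma>2 \<delta> \<omega> \<theta>A) x))
             \<longlongrightarrow> 0) (at l0 within Param_set)"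
    (is "(?f \<longlongrightarrow> 0) _")
proof (rule Lim_null_comparison)
  show "((\<lambda>l. \<bar>?g l\<bar> * Lp_norm p x) \<longlongrightarrow> 0) (at l0 within Param_set)"
    using tendsto_mult_left_zero[OF tendsto_rabs_zero[OF lim]] by simp
  have "norm (?f l) \<le> \<bar>?g l\<bar> * Lp_norm p x" if l: "l \<in> Param_set" for l
  proof -
    obtain \<theta>A \<theta>B \<alpha>1 \<beta>1 \<alpha> \<beta> \<sigma>1 \<sigma>2 \<delta> \<omega> where
      l_eq: "l = (\<theta>A, \<theta>B, \<alpha>1, \<beta>1, \<alpha>, \<beta>, \<sigma>1, \<sigma>2, \<delta>, \<omega>)"
      by (metis prod.exhaust)
    interpret trig_kernel \<alpha>1 \<beta>1 \<alpha> \<beta> \<sigma>1 \<sigma>2 \<omega>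
      using l unfolding l_eq by (rule Param_set_trig_kernel)
    have \<delta>: "\<delta> \<noteq> 0"
      using l unfolding l_eq by (rule Param_set_trig_kernel)
    have "lambda_tilde p q \<alpha>1 \<beta>1 \<alpha> \<beta> = norm_const p"
      using p q by (rule norm_const_eq_lambda_tilde)
    then show ?thesis
      using trig_op_bounded(2)[OF p x, of 0 0 "\<theta>A * \<sigma>2 * \<theta>B"]
        Lp_norm_nonneg[OF trig_op_bounded(1)[OF p, of 0 0 "\<theta>A * \<sigma>2 * \<theta>B" x]]
      by (simp add: l_eq commutator[OF p \<delta> x] 
          abs_mult norm_const_nonneg)
  qed
  then show "\<forall>\<^sub>F l in at l0 within Param_set. norm (?f l) \<le> \<bar>?g l\<bar> * Lp_norm p x"
    by (auto simp: eventually_at_filter)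
qed

theorem theorem7:
  fixes p :: ennreal
    and q \<theta>A \<theta>B \<omega> \<delta> \<alpha> \<beta> \<alpha>1 \<beta>1 \<sigma>1 \<sigma>2 :: real
    and \<theta> \<zeta> :: "nat \<Rightarrow> real"
    and A B A_lim :: fun_op
    and An Bn :: "nat \<Rightarrow> fun_op"
  assumes "1 \<le> p"
    and "1 < p \<Longrightarrow> p < \<infinity> \<Longrightarrow> 1 / enn2real p + 1 / q = 1"
    and "\<delta> \<noteq> 0" and "\<alpha>1 < \<beta>1" and "\<alpha> \<le> \<alpha>1" and "\<beta> \<ge> \<beta>1"
    and "\<omega> / pi * (\<beta>1 - \<alpha>1) \<in> \<int> \<or> \<omega> / pi * (\<beta>1 + \<alpha>1) \<in> \<int>"
    and "\<sigma>1 = (LINT s:{\<alpha>1..\<beta>1}|lebesgue. (sin (\<omega> * s))\<^sup>2)"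
    and "\<sigma>2 = (LINT s:{\<alpha>1..\<beta>1}|lebesgue. (cos (\<omega> * s))\<^sup>2)"
    and "\<sigma>1 \<noteq> 0" and "\<sigma>2 \<noteq> 0"
  defines "A \<equiv> op_A \<alpha>1 \<beta>1 \<alpha> \<beta> \<sigma>1 \<sigma>2 \<delta> \<omega> \<theta>A"
    and "B \<equiv> op_B \<alpha>1 \<beta>1 \<alpha> \<beta> \<sigma>1 \<sigma>2 \<omega> \<theta>B"
    and "An \<equiv> (\<lambda>n. op_A \<alpha>1 \<beta>1 \<alpha> \<beta> \<sigma>1 \<sigma>2 \<delta> \<omega> (\<theta> n))"
    and "Bn \<equiv> (\<lambda>n. op_B \<alpha>1 \<beta>1 \<alpha> \<beta> \<sigma>1 \<sigma>2 \<omega> (\<zeta> n))"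
    and "A_lim \<equiv> op_A_lim \<alpha>1 \<beta>1 \<alpha> \<beta> \<sigma>1 \<sigma>2 \<delta> \<omega>"
  shows
    "(Lp_operator p A \<and> Lp_operator p B \<and> Lp_operator p A_lim \<and>
      (\<forall>n\<ge>1. Lp_operator p (An n) \<and> Lp_operator p (Bn n)))
     \<and>
     (Lp_op_eq p (A \<circ> B) (op_scale \<delta> (B \<circ> (A ^^ 2))) \<and>
      (\<forall>n\<ge>1.
         Lp_op_eq p (An n \<circ> B) (op_scale \<delta> (B \<circ> (An n ^^ 2))) \<and>
         Lp_op_eq p (An n \<circ> Bn n) (op_scale \<delta> (Bn n \<circ> (An n ^^ 2))) \<and>
         Lp_op_eq p (A \<circ> Bn n) (op_scale \<delta> (Bn n \<circ> (A ^^ 2)))) \<and>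
      (\<forall>x\<in>Lp p. AE t in lebesgue.
         op_diff (A \<circ> B) (B \<circ> A) x t =
           \<theta>A * \<sigma>2 * \<theta>B *
             (LINT s:{\<alpha>1..\<beta>1}|lebesgue.
                indicator {\<alpha>..\<beta>} t * cos (\<omega> * t) * sin (\<omega> * s) * x s)))
     \<and>
     (\<theta> \<longlonglongrightarrow> 0 \<longrightarrow>
        Lp_op_tendsto p An A_lim \<and>
        Lp_op_tendsto p (\<lambda>n. op_diff (An n \<circ> B) (B \<circ> An n)) op_zero \<and>
        Lp_op_eq p (A_lim \<circ> B) (B \<circ> A_lim))
     \<and>
     (\<zeta> \<longlonglongrightarrow> 0 \<longrightarrow>
        Lp_op_tendsto p Bn op_zero \<and>
        Lp_op_tendsto p (\<lambda>n. op_diff (A \<circ> Bn n) (Bn n \<circ> A)) op_zero)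
     \<and>
     (\<theta> \<longlonglongrightarrow> 0 \<longrightarrow> \<zeta> \<longlonglongrightarrow> 0 \<longrightarrow>
        Lp_op_tendsto p (\<lambda>n. op_diff (An n \<circ> Bn n) (Bn n \<circ> An n)) op_zero)
     \<and>
     (\<forall>l0\<in>closure Param_set.
        ((\<lambda>(\<theta>A, \<theta>B, \<alpha>1, \<beta>1, \<alpha>, \<beta>, \<sigma>1, \<sigma>2, \<delta>, \<omega>).
            \<theta>A * \<sigma>2 * \<theta>B * lambda_tilde p q \<alpha>1 \<beta>1 \<alpha> \<beta>) \<longlongrightarrow> 0)
          (at l0 within Param_set) \<longrightarrow>
        (\<forall>x\<in>Lp p.
           ((\<lambda>(\<theta>A, \<theta>B, \<alpha>1, \<beta>1, \<alpha>, \<beta>, \<sigma>1, \<sigma>2, \<delta>, \<omega>).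
               Lp_norm p
                 (op_diff
                   (op_A \<alpha>1 \<beta>1 \<alpha> \<beta> \<sigma>1 \<sigma>2 \<delta> \<omega> \<theta>A \<circ> op_B \<alpha>1 \<beta>1 \<alpha> \<beta> \<sigma>1 \<sigma>2 \<omega> \<theta>B)
                   (op_B \<alpha>1 \<beta>1 \<alpha> \<beta> \<sigma>1 \<sigma>2 \<omega> \<theta>B \<circ> op_A \<alpha>1 \<beta>1 \<alpha> \<beta> \<sigma>1 \<sigma>2 \<delta> \<omega> \<theta>A) x))
             \<longlongrightarrow> 0) (at l0 within Param_set)))"
proof -
  \<comment> \<open>For $\omega = 0$ the sine vanishes, and $\sigma_1$ with it.\<close>
  have \<omega>: "\<omega> \<noteq> 0"
    using assms(8,10) by (auto simp: set_lebesgue_integral_def)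
  interpret trig_kernel \<alpha>1 \<beta>1 \<alpha> \<beta> \<sigma>1 \<sigma>2 \<omega>
  proof
    show "(LINT s:{\<alpha>1..\<beta>1}|lebesgue. sin (\<omega> * s) * cos (\<omega> * s)) = 0"
      using assms(4,7) by (intro sin_cos_orthogonal[OF \<omega>]) auto
  qed (fact assms)+
  note p = \<open>1 \<le> p\<close>
  note \<delta> = \<open>\<delta> \<noteq> 0\<close>
  note defs = A_def B_def An_def Bn_def A_lim_def op_A_lim_eq_op_A
  have A0: "op_diff (op_A \<alpha>1 \<beta>1 \<alpha> \<beta> \<sigma>1 \<sigma>2 \<delta> \<omega> u) (op_A \<alpha>1 \<beta>1 \<alpha> \<beta> \<sigma>1 \<sigma>2 \<delta> \<omega> 0) x
      = trig_op (u * 0) (u * 0) (u * 1) x" if "x \<in> Lp p" for u x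
    by (simp add: op_diff_def A_eq[OF p \<delta> that] fun_eq_iff) (simp add: trig_op_def algebra_simps)
  have B0: "op_diff (op_B \<alpha>1 \<beta>1 \<alpha> \<beta> \<sigma>1 \<sigma>2 \<omega> u) op_zero x
      = trig_op (u * 1) (u * (2 * \<sigma>2 / \<sigma>1)) (u * 0) x" if "x \<in> Lp p" for u x
    by (simp add: op_diff_def op_zero_def B_eq[OF p \<delta> that] fun_eq_iff mult_ac)
  have comm0: "op_diff (op_diff (op_A \<alpha>1 \<beta>1 \<alpha> \<beta> \<sigma>1 \<sigma>2 \<delta> \<omega> u \<circ> op_B \<alpha>1 \<beta>1 \<alpha> \<beta> \<sigma>1 \<sigma>2 \<omega> v)
        (op_B \<alpha>1 \<beta>1 \<alpha> \<beta> \<sigma>1 \<sigma>2 \<omega> v \<circ> op_A \<alpha>1 \<beta>1 \<alpha> \<beta> \<sigma>1 \<sigma>2 \<delta> \<omega> u)) op_zero x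
      = trig_op (u * v * 0) (u * v * 0) (u * v * \<sigma>2) x" if "x \<in> Lp p" for u v x
    using commutator[OF p \<delta> that, of u v] by (simp add: op_diff_def op_zero_def mult_ac)
  have comm_tendsto: "Lp_op_tendsto p
      (\<lambda>n. op_diff (op_A \<alpha>1 \<beta>1 \<alpha> \<beta> \<sigma>1 \<sigma>2 \<delta> \<omega> (u n) \<circ> op_B \<alpha>1 \<beta>1 \<alpha> \<beta> \<sigma>1 \<sigma>2 \<omega> (v n))
        (op_B \<alpha>1 \<beta>1 \<alpha> \<beta> \<sigma>1 \<sigma>2 \<omega> (v n) \<circ> op_A \<alpha>1 \<beta>1 \<alpha> \<beta> \<sigma>1 \<sigma>2 \<delta> \<omega> (u n))) op_zero"
    if "(\<lambda>n. u n * v n) \<longlonglongrightarrow> 0" for u v :: "nat \<Rightarrow> real"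
    using p that comm0 by (rule trig_op_tendsto)
  have operators: "Lp_operator p (op_A \<alpha>1 \<beta>1 \<alpha> \<beta> \<sigma>1 \<sigma>2 \<delta> \<omega> u)" "Lp_operator p (op_B \<alpha>1 \<beta>1 \<alpha> \<beta> \<sigma>1 \<sigma>2 \<omega> u)" for u
    using trig_op_Lp_operator[OF p A_eq[OF p \<delta>]] trig_op_Lp_operator[OF p B_eq[OF p \<delta>]] by blast+
  have cov: "Lp_op_eq p (op_A \<alpha>1 \<beta>1 \<alpha> \<beta> \<sigma>1 \<sigma>2 \<delta> \<omega> u \<circ> op_B \<alpha>1 \<beta>1 \<alpha> \<beta> \<sigma>1 \<sigma>2 \<omega> v)
      (op_scale \<delta> (op_B \<alpha>1 \<beta>1 \<alpha> \<beta> \<sigma>1 \<sigma>2 \<omega> v \<circ> (op_A \<alpha>1 \<beta>1 \<alpha> \<beta> \<sigma>1 \<sigma>2 \<delta> \<omega> u ^^ 2)))" for u v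
    using covariance[OF p \<delta>] by (simp add: Lp_op_eq_def)
  have comm: "op_diff (A \<circ> B) (B \<circ> A) x t = \<theta>A * \<sigma>2 * \<theta>B *
      (LINT s:{\<alpha>1..\<beta>1}|lebesgue. indicator {\<alpha>..\<beta>} t * cos (\<omega> * t) * sin (\<omega> * s) * x s)"
    if "x \<in> Lp p" for x t
    unfolding A_def B_def commutator[OF p \<delta> that]
    by (simp add: trig_op_def sin_moment_def mult.assoc)
  have lim_comm: "Lp_op_eq p (A_lim \<circ> B) (B \<circ> A_lim)"
    unfolding Lp_op_eq_def
  proof
    fix x assume "x \<in> Lp p"
    from commutator[OF p \<delta> this, of 0 \<theta>B] show "AE t in lebesgue. (A_lim \<circ> B) x t = (B \<circ> A_lim) x t"
      by (simp add: defs op_diff_def trig_op_def fun_eq_iff)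
  qed
  have p3: "Lp_op_tendsto p An A_lim" if "\<theta> \<longlonglongrightarrow> 0"
    unfolding defs using p that A0 by (rule trig_op_tendsto)
  have p4: "Lp_op_tendsto p Bn op_zero" if "\<zeta> \<longlonglongrightarrow> 0"
    unfolding defs using p that B0 by (rule trig_op_tendsto)
  show ?thesis
  proof (intro conjI impI allI ballI)
    fix l0 :: params and x
    assume "((\<lambda>(\<theta>A, \<theta>B, \<alpha>1, \<beta>1, \<alpha>, \<beta>, \<sigma>1, \<sigma>2, \<delta>, \<omega>).
            \<theta>A * \<sigma>2 * \<theta>B * lambda_tilde p q \<alpha>1 \<beta>1 \<alpha> \<beta>) \<longlongrightarrow> 0) (at l0 within Param_set)"
      and "x \<in> Lp p"
    then show "((\<lambda>(\<theta>A, \<theta>B, \<alpha>1, \<beta>1, \<alpha>, \<beta>, \<sigma>1, \<sigma>2, \<delta>, \<omega>).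
               Lp_norm p
                 (op_diff
                   (op_A \<alpha>1 \<beta>1 \<alpha> \<beta> \<sigma>1 \<sigma>2 \<delta> \<omega> \<theta>A \<circ> op_B \<alpha>1 \<beta>1 \<alpha> \<beta> \<sigma>1 \<sigma>2 \<omega> \<theta>B)
                   (op_B \<alpha>1 \<beta>1 \<alpha> \<beta> \<sigma>1 \<sigma>2 \<omega> \<theta>B \<circ> op_A \<alpha>1 \<beta>1 \<alpha> \<beta> \<sigma>1 \<sigma>2 \<delta> \<omega> \<theta>A) x))
             \<longlongrightarrow> 0) (at l0 within Param_set)"
      by (intro commutator_norm_tendsto[OF p assms(2)])
  next
    show "Lp_op_tendsto p (\<lambda>n. op_diff (An n \<circ> B) (B \<circ> An n)) op_zero" if "\<theta> \<longlonglongrightarrow> 0"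
      unfolding defs by (rule comm_tendsto) (rule tendsto_mult_left_zero[OF that])
    show "Lp_op_tendsto p (\<lambda>n. op_diff (A \<circ> Bn n) (Bn n \<circ> A)) op_zero" if "\<zeta> \<longlonglongrightarrow> 0"
      unfolding defs by (rule comm_tendsto) (rule tendsto_mult_right_zero[OF that])
    show "Lp_op_tendsto p (\<lambda>n. op_diff (An n \<circ> Bn n) (Bn n \<circ> An n)) op_zero"
      if "\<theta> \<longlonglongrightarrow> 0" "\<zeta> \<longlonglongrightarrow> 0"
      unfolding defs by (rule comm_tendsto) (rule tendsto_mult_zero[OF that])
    show "AE t in lebesgue. op_diff (A \<circ> B) (B \<circ> A) x t = \<theta>A * \<sigma>2 * \<theta>B *
        (LINT s:{\<alpha>1..\<beta>1}|lebesgue. indicator {\<alpha>..\<beta>} t * cos (\<omega> * t) * sin (\<omega> * s) * x s)"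
      if "x \<in> Lp p" for x
      by (simp only: comm[OF that] simp_thms AE_I2)
  qed (rule lim_comm | erule p3 p4 | simp only: defs operators cov)+
qed

end
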